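(* Suppose $k \in \mathbb{N}$ and $\Gamma = (M; R)$ is a $k$-sparse graph in which all vertices have infinite valency. Suppose $G$ is a topological group which acts continuously (by automorphisms) on $\Gamma$. If $H \leq G$ is extremely amenable, then $H$ has infinitely many orbits on $M^2$.
   Context: Graphs are undirected, without loops or multiple edges: $R$ is a set of $2$-element subsets of $M$. A graph $(M;R)$ is $k$-sparse if for every finite $B \subseteq M$ the number of edges of the induced subgraph on $B$ is at most $k|B|$. A topological group $G$ acts continuously by automorphisms on $\Gamma$ if it acts by graph automorphisms and the action $G \times M \to M$ is continuous with $M$ discrete, i.e. stabilizers of vertices are open in $G$. Subgroups carry the subspace topology. A topological group $H$ is extremely amenable if every continuous action of $H$ on a non-empty compact Hausdorff space has a fixed point. *)

theory Defs
  imports "HOL-Analysis.Analysis" "HOL-Algebra.Group_Action"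
begin

section \<open>Sparse graphs\<close>

locale simple_graph =
  fixes M :: "'v set" and R :: "'v set set"
  assumes edges: "e \<in> R \<Longrightarrow> e \<subseteq> M \<and> card e = 2"

definition k_sparse :: "nat \<Rightarrow> 'v set \<Rightarrow> 'v set set \<Rightarrow> bool" where
  "k_sparse k M R \<longleftrightarrow> (\<forall>B \<subseteq> M. finite B \<longrightarrow> card {e \<in> R. e \<subseteq> B} \<le> k * card B)"

definition neighbours :: "'v set set \<Rightarrow> 'v \<Rightarrow> 'v set" where
  "neighbours R x = {y. {x, y} \<in> R}"

definition graph_automorphism :: "'v set \<Rightarrow> 'v set set \<Rightarrow> ('v \<Rightarrow> 'v) \<Rightarrow> bool" where
  "graph_automorphism M R f \<longleftrightarrow>
     bij_betw f M M \<and> (\<forall>x\<in>M. \<forall>y\<in>M. {f x, f y} \<in> R \<longleftrightarrow> {x, y} \<in> R)"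


section \<open>Topological groups and continuous actions\<close>

locale topological_group = group G for G (structure) +
  fixes T
  assumes topspace_eq: "topspace T = carrier G"
    and continuous_mult: "continuous_map (prod_topology T T) T (\<lambda>(x, y). x \<otimes> y)"
    and continuous_inv: "continuous_map T T (\<lambda>x. inv x)"

definition continuous_action ::
    "('g, 'r) monoid_scheme \<Rightarrow> 'g topology \<Rightarrow> 'x topology \<Rightarrow> ('g \<Rightarrow> 'x \<Rightarrow> 'x) \<Rightarrow> bool" where
  "continuous_action G T X \<phi> \<longleftrightarrow>
     group_action G (topspace X) \<phi> \<and>
     continuous_map (prod_topology T X) X (\<lambda>(g, x). \<phi> g x)"

definition acts_by_automorphisms ::
    "('g, 'r) monoid_scheme \<Rightarrow> 'g topology \<Rightarrow> 'v set \<Rightarrow> 'v set set \<Rightarrow> ('g \<Rightarrow> 'v \<Rightarrow> 'v) \<Rightarrow> bool" where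
  "acts_by_automorphisms G T M R \<phi> \<longleftrightarrow>
     continuous_action G T (discrete_topology M) \<phi> \<and>
     (\<forall>g \<in> carrier G. graph_automorphism M R (\<phi> g))"

text \<open>
  The restriction makes each map extensional on \<open>M \<times> M\<close>, as the library's notion of a
  group action requires.
\<close>
definition pair_action :: "'v set \<Rightarrow> ('g \<Rightarrow> 'v \<Rightarrow> 'v) \<Rightarrow> 'g \<Rightarrow> 'v \<times> 'v \<Rightarrow> 'v \<times> 'v" where
  "pair_action M \<phi> g = (\<lambda>(x, y) \<in> M \<times> M. (\<phi> g x, \<phi> g y))"


section \<open>Extreme amenability\<close>

text \<open>
  A definition cannot quantify over all types, so the compact spaces range over all topologies
  on subsets of the type \<open>'g set set\<close>. This loses no generality: in a compact Hausdorff space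
  acted on by \<open>G\<close>, the closure of an orbit is a nonempty compact invariant subspace, and it
  injects into \<open>'g set set\<close>. Lemma \<open>extremely_amenable_fixed_point\<close> below derives the
  fixed point property for spaces over an arbitrary type.
\<close>
definition extremely_amenable :: "('g, 'r) monoid_scheme \<Rightarrow> 'g topology \<Rightarrow> bool" where
  "extremely_amenable G T \<longleftrightarrow> topological_group G T \<and>
     (\<forall>(X :: 'g set set topology) \<phi>.
        compact_space X \<and> Hausdorff_space X \<and> topspace X \<noteq> {} \<and> continuous_action G T X \<phi> \<longrightarrow>
        (\<exists>x \<in> topspace X. \<forall>g \<in> carrier G. \<phi> g x = x))"

lemma group_actionI:
  assumes "group G"
    and closed: "\<And>g x. g \<in> carrier G \<Longrightarrow> x \<in> E \<Longrightarrow> \<psi> g x \<in> E"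
    and ext: "\<And>g. g \<in> carrier G \<Longrightarrow> \<psi> g \<in> extensional E"
    and one: "\<And>x. x \<in> E \<Longrightarrow> \<psi> \<one>\<^bsub>G\<^esub> x = x"
    and mult: "\<And>g h x. g \<in> carrier G \<Longrightarrow> h \<in> carrier G \<Longrightarrow> x \<in> E \<Longrightarrow>
                 \<psi> (g \<otimes>\<^bsub>G\<^esub> h) x = \<psi> g (\<psi> h x)"
  shows "group_action G E \<psi>"
proof -
  interpret group G by fact
  have inv1: "\<psi> (inv\<^bsub>G\<^esub> g) (\<psi> g x) = x" "\<psi> g (\<psi> (inv\<^bsub>G\<^esub> g) x) = x"
    if "g \<in> carrier G" "x \<in> E" for g x
    using that mult[of "inv\<^bsub>G\<^esub> g" g x] mult[of g "inv\<^bsub>G\<^esub> g" x] one by auto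
  have bij: "\<psi> g \<in> Bij E" if g: "g \<in> carrier G" for g
  proof -
    have "bij_betw (\<psi> g) E E"
      by (rule bij_betw_byWitness[where f' = "\<psi> (inv\<^bsub>G\<^esub> g)"]) (use g inv1 closed in auto)
    then show ?thesis using ext[OF g] by (simp add: Bij_def)
  qed
  have "\<psi> \<in> hom G (BijGroup E)"
  proof (rule homI)
    fix g h assume gh: "g \<in> carrier G" "h \<in> carrier G"
    have "\<psi> (g \<otimes>\<^bsub>G\<^esub> h) = compose E (\<psi> g) (\<psi> h)"
      by (rule extensionalityI[of _ E]) (use gh ext mult in \<open>auto simp: compose_eq\<close>)
    then show "\<psi> (g \<otimes>\<^bsub>G\<^esub> h) = \<psi> g \<otimes>\<^bsub>BijGroup E\<^esub> \<psi> h"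
      using gh bij by (simp add: BijGroup_def)
  qed (use bij in \<open>simp add: BijGroup_def\<close>)
  then show ?thesis
    by (simp add: group_action_def group_hom_def group_hom_axioms_def group_BijGroup
        \<open>group G\<close>)
qed

lemma extremely_amenable_fixed_point:
  fixes G :: "('g, 'r) monoid_scheme" and X :: "'x topology"
  assumes ea: "extremely_amenable G T"
    and comp: "compact_space X" and haus: "Hausdorff_space X" and ne: "topspace X \<noteq> {}"
    and act: "continuous_action G T X \<phi>"
  shows "\<exists>x \<in> topspace X. \<forall>g \<in> carrier G. \<phi> g x = x"
proof -
  interpret topological_group G T using ea by (simp add: extremely_amenable_def)
  interpret A: group_action G "topspace X" \<phi>
    using act by (simp add: continuous_action_def)
  have contact: "continuous_map (prod_topology T X) X (\<lambda>(g, x). \<phi> g x)"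
    using act by (simp add: continuous_action_def)
  have \<phi>_in: "\<phi> g x \<in> topspace X" if "g \<in> carrier G" "x \<in> topspace X" for g x
    using that A.element_image by blast
  have \<phi>_cont: "continuous_map X X (\<phi> g)" if "g \<in> carrier G" for g
  proof -
    have "continuous_map X (prod_topology T X) (\<lambda>x. (g, x))"
      using that topspace_eq by (intro continuous_map_pairedI) auto
    from continuous_map_compose[OF this contact] show ?thesis by (simp add: o_def)
  qed
  obtain x0 where x0: "x0 \<in> topspace X" using ne by blast
  define Or where "Or = (\<lambda>g. \<phi> g x0) ` carrier G"
  define C where "C = Abstract_Topology.closure_of X Or"
  have Or_sub: "Or \<subseteq> topspace X" using \<phi>_in x0 by (auto simp: Or_def)
  have C_sub: "C \<subseteq> topspace X" unfolding C_def by (rule closure_of_subset_topspace)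
  have OrC: "Or \<subseteq> C" unfolding C_def by (rule closure_of_subset[OF Or_sub])
  have C_ne: "C \<noteq> {}" using OrC by (auto simp: Or_def)
  have C_inv: "\<phi> g x \<in> C" if g: "g \<in> carrier G" and x: "x \<in> C" for g x
  proof -
    have "\<phi> g ` Or \<subseteq> Or"
      using g unfolding Or_def by (auto simp flip: A.composition_rule[OF x0 g])
    then have "\<phi> g ` C \<subseteq> C"
      unfolding C_def
      by (meson \<phi>_cont closure_of_mono continuous_map_image_closure_subset g order_trans)
    then show ?thesis using x by blast
  qed
  define j :: "'x \<Rightarrow> 'g set set"
    where "j y = {A. A \<subseteq> carrier G \<and> y \<in> Abstract_Topology.closure_of X ((\<lambda>g. \<phi> g x0) ` A)}" for y
  have inj: "inj_on j C"
  proof (rule inj_onI, rule ccontr)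
    fix y z assume y: "y \<in> C" and z: "z \<in> C" and jj: "j y = j z" and "y \<noteq> z"
    then obtain U V where UV: "openin X U" "openin X V" "y \<in> U" "z \<in> V" "disjnt U V"
      using haus C_sub unfolding Hausdorff_space_def by (meson subsetD)
    define A where "A = {g \<in> carrier G. \<phi> g x0 \<in> U}"
    have "y \<in> Abstract_Topology.closure_of X ((\<lambda>g. \<phi> g x0) ` A)"
      unfolding in_closure_of
    proof (intro conjI allI impI)
      show "y \<in> topspace X" using y C_sub by blast
      fix W assume W: "y \<in> W \<and> openin X W"
      then have "openin X (U \<inter> W)" "y \<in> U \<inter> W" using UV by auto
      then obtain w where "w \<in> Or" "w \<in> U \<inter> W"
        using y unfolding C_def in_closure_of by blast
      then show "\<exists>w. w \<in> (\<lambda>g. \<phi> g x0) ` A \<and> w \<in> W"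
        by (auto simp: Or_def A_def)
    qed
    then have "A \<in> j y" by (auto simp: j_def A_def)
    then have "z \<in> Abstract_Topology.closure_of X ((\<lambda>g. \<phi> g x0) ` A)"
      unfolding jj by (simp add: j_def)
    then obtain w where "w \<in> (\<lambda>g. \<phi> g x0) ` A" "w \<in> V"
      using UV unfolding in_closure_of by blast
    then show False using UV by (auto simp: A_def disjnt_def)
  qed
  define f where "f = inv_into C j"
  have fj: "f (j y) = y" if "y \<in> C" for y using that inj by (simp add: f_def)
  define Y where "Y = pullback_topology (j ` C) f (subtopology X C)"
  have topY: "topspace Y = j ` C"
    using C_sub fj by (auto simp: Y_def topspace_pullback_topology)
  have fY: "continuous_map Y (subtopology X C) f"
    unfolding Y_def using continuous_map_pullback[OF continuous_map_id, of "j ` C" f]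
    by (simp add: id_def o_def)
  have jY: "continuous_map (subtopology X C) Y j"
    unfolding Y_def
  proof (rule continuous_map_pullback')
    show "continuous_map (subtopology X C) (subtopology X C) (f \<circ> j)"
      by (rule continuous_map_eq[OF continuous_map_id]) (auto simp: fj)
  qed auto
  have "homeomorphic_maps Y (subtopology X C) f j"
    unfolding homeomorphic_maps_def using fY jY C_sub by (auto simp: topY fj)
  then have hom: "Y homeomorphic_space subtopology X C"
    by (rule homeomorphic_maps_imp_homeomorphic_space)
  have "compact_space (subtopology X C)"
    by (simp add: C_def closedin_compact_space comp compact_space_subtopology)
  then have compY: "compact_space Y" using hom homeomorphic_compact_space by blast
  have hausY: "Hausdorff_space Y"
    using hom haus Hausdorff_space_subtopology homeomorphic_Hausdorff_space by blast
  define \<psi> where "\<psi> g = (\<lambda>z \<in> j ` C. j (\<phi> g (f z)))" for g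
  have \<phi>_one: "\<phi> \<one>\<^bsub>G\<^esub> x = x" if "x \<in> topspace X" for x
    using A.id_eq_one that by (metis restrict_apply')
  have gaY: "group_action G (topspace Y) \<psi>"
    unfolding topY
  proof (rule group_actionI)
    fix g h x assume "g \<in> carrier G" "h \<in> carrier G" "x \<in> j ` C"
    then show "\<psi> (g \<otimes>\<^bsub>G\<^esub> h) x = \<psi> g (\<psi> h x)"
      using C_sub C_inv by (auto simp: \<psi>_def fj A.composition_rule subset_iff)
  qed (use C_sub in \<open>auto simp: \<psi>_def fj C_inv \<phi>_one subset_iff is_group\<close>)
  have "continuous_map (prod_topology T Y) Y (\<lambda>(g, z). \<psi> g z)"
  proof -
    have "continuous_map Y X f"
      using fY by (simp add: continuous_map_in_subtopology)
    then have "continuous_map (prod_topology T Y) X (f \<circ> snd)"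
      using continuous_map_compose continuous_map_snd by blast
    then have "continuous_map (prod_topology T Y) (prod_topology T X) (\<lambda>p. (fst p, f (snd p)))"
      by (intro continuous_map_pairedI continuous_map_fst) (simp add: o_def)
    from continuous_map_compose[OF this contact]
    have "continuous_map (prod_topology T Y) X (\<lambda>p. \<phi> (fst p) (f (snd p)))"
      by (simp add: o_def)
    then have "continuous_map (prod_topology T Y) (subtopology X C) (\<lambda>p. \<phi> (fst p) (f (snd p)))"
      using C_inv fj by (auto simp: continuous_map_in_subtopology topY topspace_eq)
    from continuous_map_compose[OF this jY] show ?thesis
      by (rule continuous_map_eq) (auto simp: topY \<psi>_def)
  qed
  then have "continuous_action G T Y \<psi>" using gaY by (simp add: continuous_action_def)
  then obtain z where z: "z \<in> topspace Y" "\<forall>g \<in> carrier G. \<psi> g z = z"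
    using ea compY hausY C_ne topY unfolding extremely_amenable_def by (metis image_is_empty)
  then obtain y where y: "y \<in> C" "z = j y" using topY by auto
  have "\<phi> g y = y" if "g \<in> carrier G" for g
    using z that y C_inv[OF that y(1)] inj by (auto simp: \<psi>_def fj inj_on_eq_iff)
  then show ?thesis using y C_sub by blast
qed

end

theory Submission
  imports Defs
begin

text \<open>
  The idea is to let \<open>H\<close> act on the compact space of orientations of the graph in which
  every vertex has at most \<open>k\<close> out-neighbours, and to show that a fixed point of this action is
  incompatible with finitely many orbits on pairs.

  Such orientations exist: every finite induced subgraph has one, by a Hall-type argument in which
  the vertices are given capacities (\<open>exists_orientation_with_capacities\<close>), and the orientations
  form a closed subset of the compact space of all relations on \<open>M\<close>, cut out by conditions on
  finitely many coordinates each, so compactness passes from finite pieces to the whole graph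
  (\<open>orientations_nonempty\<close>). Since vertex stabilizers are open, \<open>H\<close> acts continuously on
  this space, and extreme amenability gives an \<open>H\<close>-invariant orientation \<open>D\<close>
  (\<open>invariant_orientation\<close>).

  Now suppose that \<open>H\<close> has finitely many orbits on \<open>M \<times> M\<close>. Each power \<open>D ^^ n\<close> is an
  \<open>H\<close>-invariant relation, hence a union of orbits, so there are only finitely many different
  powers. Every vertex has at most \<open>k ^ n\<close> out-neighbours for \<open>D ^^ n\<close>, and therefore
  \<open>D\<^sup>+\<close> has uniformly bounded out-degree (\<open>trancl_out_bounded\<close>). On the other hand, infinite
  valency and finite out-degree make every in-degree infinite, so one can walk backwards along
  \<open>D\<close> through new vertices for as long as one likes; the last vertex of a long walk has all
  the earlier ones as descendants (\<open>many_descendants\<close>), which contradicts the bound.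
\<close>

section \<open>Orienting finite sparse graphs\<close>

text \<open>
  A vertex is chosen in each edge (its tail), and \<open>c v\<close> bounds how often \<open>v\<close> may be chosen.
  Induction on the edges: remove an edge \<open>{x, y}\<close>, and try to charge it to \<open>x\<close> or to \<open>y\<close>,
  lowering that capacity by one. If charging it to \<open>x\<close> is impossible, there is a tight set
  containing \<open>x\<close> but not \<open>y\<close>, whose capacity is used up by the remaining edges inside
  it; likewise for \<open>y\<close>. The number of edges inside a set is supermodular and the edge
  \<open>{x, y}\<close> lies inside the union of the two tight sets but inside neither of them, so the union
  would contain more edges than its capacity allows.
\<close>
lemma exists_orientation_with_capacities:
  fixes E :: "'v set set" and c :: "'v \<Rightarrow> nat"
  assumes "finite E" and "\<And>e. e \<in> E \<Longrightarrow> card e = 2"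
    and "\<And>B. finite B \<Longrightarrow> card {e \<in> E. e \<subseteq> B} \<le> sum c B"
  shows "\<exists>t. (\<forall>e \<in> E. t e \<in> e) \<and> (\<forall>v. card {e \<in> E. t e = v} \<le> c v)"
  using assms
proof (induction E arbitrary: c rule: finite_induct)
  case empty
  then show ?case by simp
next
  case (insert e F)
  obtain x y where e: "e = {x, y}" "x \<noteq> y"
    using insert.prems(1)[of e] by (auto simp: card_2_iff)
  have fin: "finite {f \<in> F. P f}" for P using insert.hyps(1) by simp
  let ?goal = "\<exists>t. (\<forall>f \<in> insert e F. t f \<in> f) \<and> (\<forall>v. card {f \<in> insert e F. t f = v} \<le> c v)"
  (* B is the tight set: it is the singleton {u} if c u = 0, and otherwise a set
     violating the hypothesis for the lowered capacities. *)
  have step: "?goal \<or> (\<exists>B. finite B \<and> u \<in> B \<and> v \<notin> B \<and> sum c B \<le> card {f \<in> F. f \<subseteq> B})"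
    if uv: "e = {u, v}" "u \<noteq> v" for u v
  proof (cases "c u = 0")
    case True
    then show ?thesis using uv by (intro disjI2 exI[of _ "{u}"]) auto
  next
    case False
    define c' where "c' = c(u := c u - 1)"
    have sum_out: "sum c' B = sum c B" if "u \<notin> B" for B
      using that by (intro sum.cong) (auto simp: c'_def)
    have sum_in: "sum c B = Suc (sum c' B)" if "u \<in> B" "finite B" for B
      using that False sum_out[of "B - {u}"] by (simp add: sum.remove[of B u] c'_def)
    show ?thesis
    proof (cases "\<forall>B. finite B \<longrightarrow> card {f \<in> F. f \<subseteq> B} \<le> sum c' B")
      case True
      then obtain t where t: "\<forall>f \<in> F. t f \<in> f" "\<And>w. card {f \<in> F. t f = w} \<le> c' w"
        using insert.IH[of c'] insert.prems(1) by auto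
      have "card {f \<in> insert e F. (t(e := u)) f = w} \<le> c w" for w
      proof (cases "w = u")
        case True
        have "{f \<in> insert e F. (t(e := u)) f = u} = insert e {f \<in> F. t f = u}"
          using insert.hyps by auto
        then show ?thesis
          using True False t(2)[of u] insert.hyps fin by (simp add: c'_def)
      next
        case neq: False
        then have "{f \<in> insert e F. (t(e := u)) f = w} = {f \<in> F. t f = w}"
          using insert.hyps by auto
        then show ?thesis using neq t(2)[of w] by (simp add: c'_def)
      qed
      then have ?goal
        using t(1) uv by (intro exI[of _ "t(e := u)"]) auto
      then show ?thesis ..
    next
      case False
      then obtain B where B: "finite B" "sum c' B < card {f \<in> F. f \<subseteq> B}"
        by (auto simp: not_le)
      have "card {f \<in> F. f \<subseteq> B} \<le> card {f \<in> insert e F. f \<subseteq> B}"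
        using insert.hyps by (intro card_mono) auto
      with insert.prems(2)[OF B(1)] B sum_out[of B] have "u \<in> B" by fastforce
      moreover have "v \<notin> B"
      proof
        assume "v \<in> B"
        then have "{f \<in> insert e F. f \<subseteq> B} = insert e {f \<in> F. f \<subseteq> B}"
          using uv \<open>u \<in> B\<close> by auto
        then have "card {f \<in> insert e F. f \<subseteq> B} = Suc (card {f \<in> F. f \<subseteq> B})"
          using insert.hyps fin by simp
        then show False
          using insert.prems(2)[OF B(1)] B sum_in[OF \<open>u \<in> B\<close> B(1)] by linarith
      qed
      ultimately show ?thesis using B sum_in[of B] by auto
    qed
  qed
  show ?case
  proof (rule ccontr)
    assume no: "\<not> ?goal"
    obtain B where B: "finite B" "x \<in> B" "y \<notin> B" "sum c B \<le> card {f \<in> F. f \<subseteq> B}"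
      using step[OF e] no by blast
    have "e = {y, x}" "y \<noteq> x" using e by auto
    from step[OF this]
    obtain C where C: "finite C" "y \<in> C" "x \<notin> C" "sum c C \<le> card {f \<in> F. f \<subseteq> C}"
      using no by blast
    have "card {f \<in> F. f \<subseteq> B} + card {f \<in> F. f \<subseteq> C}
        = card ({f \<in> F. f \<subseteq> B} \<union> {f \<in> F. f \<subseteq> C}) + card {f \<in> F. f \<subseteq> B \<inter> C}"
    proof -
      have "{f \<in> F. f \<subseteq> B} \<inter> {f \<in> F. f \<subseteq> C} = {f \<in> F. f \<subseteq> B \<inter> C}" by auto
      then show ?thesis using card_Un_Int[OF fin fin, of "\<lambda>f. f \<subseteq> B" "\<lambda>f. f \<subseteq> C"] by simp
    qed
    moreover have "card {f \<in> F. f \<subseteq> B \<inter> C} \<le> sum c (B \<inter> C)"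
    proof -
      have "card {f \<in> F. f \<subseteq> B \<inter> C} \<le> card {f \<in> insert e F. f \<subseteq> B \<inter> C}"
        using insert.hyps by (intro card_mono) auto
      then show ?thesis using insert.prems(2)[of "B \<inter> C"] B(1) by simp
    qed
    moreover have "Suc (card ({f \<in> F. f \<subseteq> B} \<union> {f \<in> F. f \<subseteq> C})) \<le> sum c (B \<union> C)"
    proof -
      have "Suc (card ({f \<in> F. f \<subseteq> B} \<union> {f \<in> F. f \<subseteq> C}))
          = card (insert e ({f \<in> F. f \<subseteq> B} \<union> {f \<in> F. f \<subseteq> C}))"
        using insert.hyps fin by simp
      also have "\<dots> \<le> card {f \<in> insert e F. f \<subseteq> B \<union> C}"
        using insert.hyps B C e by (intro card_mono) auto
      also have "\<dots> \<le> sum c (B \<union> C)"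
        using B(1) C(1) by (intro insert.prems(2)) auto
      finally show ?thesis .
    qed
    moreover have "sum c (B \<union> C) + sum c (B \<inter> C) = sum c B + sum c C"
      using B(1) C(1) by (rule sum.union_inter)
    ultimately show False using B(4) C(4) by linarith
  qed
qed

text \<open>
  The predicate \<open>f\<close> may also hold at pairs off the graph, and at both \<open>(x, y)\<close> and
  \<open>(y, x)\<close>: all that matters is that every edge gets at least one direction and that the
  out-degrees are bounded.
\<close>
definition orients :: "nat \<Rightarrow> 'v set set \<Rightarrow> 'v set \<Rightarrow> ('v \<times> 'v \<Rightarrow> bool) \<Rightarrow> bool" where
  "orients k R B f \<longleftrightarrow>
     (\<forall>x\<in>B. \<forall>y\<in>B. {x, y} \<in> R \<longrightarrow> f (x, y) \<or> f (y, x)) \<and>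
     (\<forall>x\<in>B. finite {y \<in> B. f (x, y)} \<and> card {y \<in> B. f (x, y)} \<le> k)"

lemma orients_cong:
  assumes "\<And>p. p \<in> B \<times> B \<Longrightarrow> f p = h p"
  shows "orients k R B f \<longleftrightarrow> orients k R B h"
proof -
  have "{y \<in> B. f (x, y)} = {y \<in> B. h (x, y)}" if "x \<in> B" for x using assms that by auto
  then show ?thesis using assms by (simp add: orients_def)
qed

lemma orients_mono:
  assumes f: "orients k R C f" and "B \<subseteq> C"
  shows "orients k R B f"
proof -
  have "finite {y \<in> B. f (x, y)} \<and> card {y \<in> B. f (x, y)} \<le> k" if "x \<in> B" for x
  proof -
    have "{y \<in> B. f (x, y)} \<subseteq> {y \<in> C. f (x, y)}" using \<open>B \<subseteq> C\<close> by auto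
    moreover have "finite {y \<in> C. f (x, y)}" "card {y \<in> C. f (x, y)} \<le> k"
      using f that \<open>B \<subseteq> C\<close> by (auto simp: orients_def)
    ultimately show ?thesis by (meson card_mono finite_subset le_trans)
  qed
  then show ?thesis using assms unfolding orients_def by blast
qed

text \<open>
  A vertex with too many out-neighbours already has \<open>Suc k\<close> of them in some finite set, so a
  violation is always visible on a finite set of vertices.
\<close>
lemma orients_locally:
  assumes "\<And>B. finite B \<Longrightarrow> B \<subseteq> M \<Longrightarrow> orients k R B f"
  shows "orients k R M f"
  unfolding orients_def
proof (intro conjI ballI impI)
  fix x y assume "x \<in> M" "y \<in> M" "{x, y} \<in> R"
  then show "f (x, y) \<or> f (y, x)" using assms[of "{x, y}"] by (simp add: orients_def)
next
  fix x assume x: "x \<in> M"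
  have "finite {y \<in> M. f (x, y)} \<and> card {y \<in> M. f (x, y)} \<le> k"
  proof (rule ccontr)
    assume "\<not> ?thesis"
    then consider "infinite {y \<in> M. f (x, y)}" | "Suc k \<le> card {y \<in> M. f (x, y)}"
      by linarith
    then obtain F where F: "finite F" "F \<subseteq> {y \<in> M. f (x, y)}" "card F = Suc k"
    proof cases
      case 1
      then show ?thesis using infinite_arbitrarily_large that by blast
    next
      case 2
      then show ?thesis using obtain_subset_with_card_n that by blast
    qed
    have "orients k R (insert x F) f" using F x by (intro assms) auto
    then have "finite {y \<in> insert x F. f (x, y)}" "card {y \<in> insert x F. f (x, y)} \<le> k"
      by (auto simp: orients_def)
    moreover have "F \<subseteq> {y \<in> insert x F. f (x, y)}" using F by auto
    ultimately have "Suc k \<le> k" unfolding F(3)[symmetric] by (meson card_mono le_trans)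
    then show False by simp
  qed
  then show "finite {y \<in> M. f (x, y)}" "card {y \<in> M. f (x, y)} \<le> k" by auto
qed

lemma finite_sparse_orientable:
  assumes graph: "simple_graph M R" and sparse: "k_sparse k M R"
    and B: "finite B" "B \<subseteq> M"
  shows "\<exists>f. orients k R B f"
proof -
  define E where "E = {e \<in> R. e \<subseteq> B}"
  have "finite E" using B(1) by (auto simp: E_def intro: finite_subset[of _ "Pow B"])
  have "\<exists>t. (\<forall>e \<in> E. t e \<in> e) \<and> (\<forall>v. card {e \<in> E. t e = v} \<le> k)"
  proof (rule exists_orientation_with_capacities[OF \<open>finite E\<close>])
    show "card e = 2" if "e \<in> E" for e
      using that simple_graph.edges[OF graph] by (auto simp: E_def)
    fix C :: "'a set" assume C: "finite C"
    have "{e \<in> E. e \<subseteq> C} = {e \<in> R. e \<subseteq> B \<inter> C}" by (auto simp: E_def)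
    then have "card {e \<in> E. e \<subseteq> C} \<le> k * card (B \<inter> C)"
      using sparse[unfolded k_sparse_def, rule_format, of "B \<inter> C"] B by (simp add: inf.coboundedI1)
    also have "\<dots> \<le> k * card C" using C by (simp add: card_mono)
    finally show "card {e \<in> E. e \<subseteq> C} \<le> (\<Sum>v\<in>C. k)" by (simp add: mult.commute)
  qed
  then obtain t where t: "\<And>e. e \<in> E \<Longrightarrow> t e \<in> e" "\<And>v. card {e \<in> E. t e = v} \<le> k"
    by blast
  define f where "f = (\<lambda>(x, y). {x, y} \<in> E \<and> t {x, y} = x)"
  have "card {y \<in> B. f (x, y)} \<le> k" for x
  proof -
    have "card {y \<in> B. f (x, y)} \<le> card {e \<in> E. t e = x}"
      by (rule card_inj_on_le[where f = "\<lambda>y. {x, y}"])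
         (use \<open>finite E\<close> in \<open>auto simp: f_def inj_on_def doubleton_eq_iff\<close>)
    then show ?thesis using t(2)[of x] by linarith
  qed
  moreover have "f (x, y) \<or> f (y, x)" if "x \<in> B" "y \<in> B" "{x, y} \<in> R" for x y
  proof -
    have "{x, y} \<in> E" using that by (simp add: E_def)
    then show ?thesis using t(1)[of "{x, y}"] by (auto simp: f_def insert_commute)
  qed
  ultimately have "orients k R B f" using B(1) by (simp add: orients_def)
  then show ?thesis by (rule exI[of _ f])
qed


section \<open>The compact space of orientations\<close>

abbreviation relation_space :: "'i set \<Rightarrow> ('i \<Rightarrow> bool) topology" where
  "relation_space I \<equiv> product_topology (\<lambda>_. discrete_topology UNIV) I"

text \<open>
  Fixing the values of \<open>f\<close> on the finite set \<open>J\<close> defines a basic open neighbourhood of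
  \<open>f\<close>, on which \<open>P\<close> is constant; so the set where \<open>P\<close> fails is open.
\<close>
lemma closedin_finitely_determined:
  assumes "finite J" and "J \<subseteq> I"
    and cong: "\<And>f h. (\<And>j. j \<in> J \<Longrightarrow> f j = h j) \<Longrightarrow> P f \<longleftrightarrow> P h"
  shows "closedin (relation_space I) {f \<in> topspace (relation_space I). P f}"
proof -
  have "openin (relation_space I) {f \<in> topspace (relation_space I). \<not> P f}"
    unfolding openin_product_topology_alt
  proof
    fix f assume f: "f \<in> {f \<in> topspace (relation_space I). \<not> P f}"
    define U where "U i = (if i \<in> J then {f i} else UNIV)" for i
    have "finite {i \<in> I. U i \<noteq> UNIV}"
      by (rule finite_subset[OF _ \<open>finite J\<close>]) (auto simp: U_def)
    moreover have "f \<in> Pi\<^sub>E I U" using f by (auto simp: U_def PiE_iff)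
    moreover have "\<not> P h" if "h \<in> Pi\<^sub>E I U" for h
    proof -
      have "f j = h j" if "j \<in> J" for j
        using \<open>h \<in> Pi\<^sub>E I U\<close> that \<open>J \<subseteq> I\<close> PiE_mem[of h I U j] by (auto simp: U_def)
      then show ?thesis using f cong by blast
    qed
    ultimately show "\<exists>U. finite {i \<in> I. U i \<noteq> topspace (discrete_topology UNIV)} \<and>
        (\<forall>i\<in>I. openin (discrete_topology UNIV) (U i)) \<and> f \<in> Pi\<^sub>E I U \<and>
        Pi\<^sub>E I U \<subseteq> {f \<in> topspace (relation_space I). \<not> P f}"
      by (intro exI[of _ U]) (auto simp: PiE_iff)
  qed
  moreover have "topspace (relation_space I) - {f \<in> topspace (relation_space I). P f}
      = {f \<in> topspace (relation_space I). \<not> P f}" by auto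
  ultimately show ?thesis unfolding closedin_def by (intro conjI Collect_restrict) metis
qed

definition orientations :: "nat \<Rightarrow> 'v set \<Rightarrow> 'v set set \<Rightarrow> ('v \<times> 'v \<Rightarrow> bool) set" where
  "orientations k M R = {f \<in> topspace (relation_space (M \<times> M)). orients k R M f}"

lemma orientations_eq_Inter:
  "orientations k M R =
     (\<Inter>B \<in> {B. finite B \<and> B \<subseteq> M}. {f \<in> topspace (relation_space (M \<times> M)). orients k R B f})"
proof -
  have "orients k R M f \<longleftrightarrow> (\<forall>B. finite B \<and> B \<subseteq> M \<longrightarrow> orients k R B f)" for f
    using orients_mono[of k R M f] orients_locally[of M k R f] by metis
  then show ?thesis unfolding orientations_def by blast
qed

lemma closedin_local_orientations:
  assumes "finite B" and "B \<subseteq> M"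
  shows "closedin (relation_space (M \<times> M))
           {f \<in> topspace (relation_space (M \<times> M)). orients k R B f}"
proof (rule closedin_finitely_determined[of "B \<times> B"])
  show "orients k R B f \<longleftrightarrow> orients k R B h" if "\<And>p. p \<in> B \<times> B \<Longrightarrow> f p = h p" for f h
    using that by (rule orients_cong)
qed (use assms in auto)

lemma closedin_orientations: "closedin (relation_space (M \<times> M)) (orientations k M R)"
  unfolding orientations_eq_Inter
proof (rule closedin_INT)
  show "{B. finite B \<and> B \<subseteq> M} \<noteq> {}" by auto
  fix B assume "B \<in> {B. finite B \<and> B \<subseteq> M}"
  then have "finite B" "B \<subseteq> M" by auto
  then show "closedin (relation_space (M \<times> M))
      {f \<in> topspace (relation_space (M \<times> M)). orients k R B f}"
    by (rule closedin_local_orientations)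
qed

text \<open>
  The finite intersection property: for finitely many finite sets \<open>B\<close>, an orientation of the
  subgraph on their union, extended arbitrarily, orients the subgraph on each \<open>B\<close>.
\<close>
lemma orientations_nonempty:
  assumes graph: "simple_graph M R" and sparse: "k_sparse k M R"
  shows "orientations k M R \<noteq> {}"
proof -
  let ?X = "relation_space (M \<times> M)"
  let ?C = "\<lambda>B. {f \<in> topspace ?X. orients k R B f}"
  have comp: "compact_space ?X"
    by (simp add: compact_space_product_topology compact_space_discrete_topology)
  have fip: "\<Inter>\<F> \<noteq> {}" if \<F>: "finite \<F>" "\<F> \<subseteq> ?C ` {B. finite B \<and> B \<subseteq> M}" for \<F>
  proof -
    obtain \<B> where \<B>: "finite \<B>" "\<B> \<subseteq> {B. finite B \<and> B \<subseteq> M}" "\<F> = ?C ` \<B>"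
      using finite_subset_image[OF \<F>] by blast
    have "finite (\<Union>\<B>)" "\<Union>\<B> \<subseteq> M" using \<B> by auto
    from finite_sparse_orientable[OF graph sparse this]
    obtain f where f: "orients k R (\<Union>\<B>) f" by (rule exE)
    let ?f = "restrict f (M \<times> M)"
    have "orients k R (\<Union>\<B>) ?f"
    proof (subst orients_cong)
      show "?f p = f p" if "p \<in> \<Union>\<B> \<times> \<Union>\<B>" for p
        using that \<open>\<Union>\<B> \<subseteq> M\<close> by (intro restrict_apply') blast
    qed (rule f)
    then have "orients k R B ?f" if "B \<in> \<B>" for B
      using that by (intro orients_mono[of k R "\<Union>\<B>" ?f B]) auto
    moreover have "?f \<in> topspace ?X" by simp
    ultimately have "?f \<in> \<Inter>\<F>" unfolding \<B>(3) by blast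
    then show ?thesis by blast
  qed
  have closed: "\<forall>S \<in> ?C ` {B. finite B \<and> B \<subseteq> M}. closedin ?X S"
  proof (rule ballI, erule imageE)
    fix S B assume "S = ?C B" "B \<in> {B. finite B \<and> B \<subseteq> M}"
    then show "closedin ?X S" using closedin_local_orientations[of B M k R] by simp
  qed
  have "\<Inter> (?C ` {B. finite B \<and> B \<subseteq> M}) \<noteq> {}"
  proof (rule comp[unfolded compact_space_fip, THEN spec, THEN mp], intro conjI allI impI)
    show "\<Inter>\<F> \<noteq> {}" if "finite \<F> \<and> \<F> \<subseteq> ?C ` {B. finite B \<and> B \<subseteq> M}" for \<F>
      by (rule fip[OF conjunct1[OF that] conjunct2[OF that]])
  qed (rule closed)
  then show ?thesis unfolding orientations_eq_Inter .
qed


section \<open>Fixed points in spaces of functions on a discrete set\<close>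

text \<open>
  The form in which continuity passes to subgroups and to pairs, and in which it is used to see
  that the action on functions is continuous.
\<close>
lemma continuous_action_discrete_iff:
  assumes "topspace T = carrier G"
  shows "continuous_action G T (discrete_topology I) \<phi> \<longleftrightarrow>
     group_action G I \<phi> \<and> (\<forall>x\<in>I. \<forall>y\<in>I. openin T {g \<in> carrier G. \<phi> g x = y})"
proof (cases "group_action G I \<phi>")
  case True
  interpret group_action G I \<phi> by fact
  let ?\<phi> = "\<lambda>(g, x). \<phi> g x"
  have "continuous_map (prod_topology T (discrete_topology I)) (discrete_topology I) ?\<phi> \<longleftrightarrow>
     (\<forall>x\<in>I. \<forall>y\<in>I. openin T {g \<in> carrier G. \<phi> g x = y})"
  proof (intro iffI ballI)
    assume cont: "continuous_map (prod_topology T (discrete_topology I)) (discrete_topology I) ?\<phi>"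
    fix x y assume "x \<in> I" "y \<in> I"
    have "continuous_map T (prod_topology T (discrete_topology I)) (\<lambda>g. (g, x))"
      using \<open>x \<in> I\<close> by (intro continuous_map_pairedI) auto
    from continuous_map_compose[OF this cont]
    have "continuous_map T (discrete_topology I) (\<lambda>g. \<phi> g x)" by (simp add: o_def)
    then have "openin T {g \<in> topspace T. \<phi> g x \<in> {y}}"
      by (rule openin_continuous_map_preimage) (use \<open>y \<in> I\<close> in simp)
    then show "openin T {g \<in> carrier G. \<phi> g x = y}" by (simp add: assms)
  next
    assume op: "\<forall>x\<in>I. \<forall>y\<in>I. openin T {g \<in> carrier G. \<phi> g x = y}"
    show "continuous_map (prod_topology T (discrete_topology I)) (discrete_topology I) ?\<phi>"
      unfolding continuous_map_def
    proof (intro conjI allI impI)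
      show "?\<phi> \<in> topspace (prod_topology T (discrete_topology I)) \<rightarrow> topspace (discrete_topology I)"
        using element_image by (auto simp: assms)
      fix U assume "openin (discrete_topology I) U"
      then have U: "U \<subseteq> I" by simp
      have "{p \<in> topspace (prod_topology T (discrete_topology I)). ?\<phi> p \<in> U}
          = (\<Union>x\<in>I. \<Union>y\<in>U. {g \<in> carrier G. \<phi> g x = y} \<times> {x})"
        by (auto simp: assms)
      then show "openin (prod_topology T (discrete_topology I))
          {p \<in> topspace (prod_topology T (discrete_topology I)). ?\<phi> p \<in> U}"
        using op U by (auto simp: openin_prod_Times_iff intro!: openin_Union)
    qed
  qed
  then show ?thesis using True by (simp add: continuous_action_def)
qed (simp add: continuous_action_def)

text \<open>
  The group acts on functions \<open>I \<rightarrow> K\<close> by \<open>(g f) i = f (g\<^sup>-\<^sup>1 i)\<close>. With the product topology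
  this action is continuous: the \<open>i\<close>-th coordinate of \<open>g f\<close> lies in \<open>U\<close> iff
  \<open>f j \<in> U\<close> for the \<open>j\<close> with \<open>g j = i\<close>, and for each \<open>j\<close> both conditions are
  open. A fixed point in \<open>C\<close> is precisely a function that is constant on orbits.
\<close>
lemma extremely_amenable_invariant_function:
  fixes K :: "'k topology" and I :: "'i set"
  assumes ea: "extremely_amenable G T"
    and act: "continuous_action G T (discrete_topology I) \<phi>"
    and K: "compact_space K" "Hausdorff_space K"
    and C: "closedin (product_topology (\<lambda>_. K) I) C" "C \<noteq> {}"
    and C_inv: "\<And>g f. g \<in> carrier G \<Longrightarrow> f \<in> C \<Longrightarrow> (\<lambda>i\<in>I. f (\<phi> g i)) \<in> C"
  shows "\<exists>f\<in>C. \<forall>g\<in>carrier G. \<forall>i\<in>I. f (\<phi> g i) = f i"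
proof -
  interpret topological_group G T using ea by (simp add: extremely_amenable_def)
  interpret A: group_action G I \<phi> using act by (simp add: continuous_action_def)
  have op: "openin T {g \<in> carrier G. \<phi> g i = j}" if "i \<in> I" "j \<in> I" for i j
    using act that by (simp add: continuous_action_discrete_iff[OF topspace_eq])
  have \<phi>_in: "\<phi> g i \<in> I" if "g \<in> carrier G" "i \<in> I" for g i
    using that A.element_image by blast
  let ?P = "product_topology (\<lambda>_. K) I"
  let ?X = "subtopology ?P C"
  have C_sub: "C \<subseteq> (\<Pi>\<^sub>E i\<in>I. topspace K)" using closedin_subset[OF C(1)] by simp
  then have topX: "topspace ?X = C" by auto
  then have topTX: "topspace (prod_topology T ?X) = carrier G \<times> C"
    by (simp only: topspace_prod_topology topspace_eq)
  have C_ext: "f \<in> extensional I" if "f \<in> C" for f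
    using that C_sub by (auto simp: PiE_def)
  define \<psi> where "\<psi> g = (\<lambda>f\<in>C. \<lambda>i\<in>I. f (\<phi> (inv\<^bsub>G\<^esub> g) i))" for g
  have "group_action G C \<psi>"
  proof (rule group_actionI)
    show "\<psi> g f \<in> C" if "g \<in> carrier G" "f \<in> C" for g f
      using that C_inv[of "inv\<^bsub>G\<^esub> g" f] by (simp add: \<psi>_def)
    show "\<psi> \<one>\<^bsub>G\<^esub> f = f" if "f \<in> C" for f
    proof (rule extensionalityI[of _ I])
      show "\<psi> \<one>\<^bsub>G\<^esub> f i = f i" if "i \<in> I" for i
        using that \<open>f \<in> C\<close> A.id_eq_one by (simp add: \<psi>_def) (metis restrict_apply')
    qed (use that C_ext in \<open>auto simp: \<psi>_def\<close>)
    show "\<psi> (g \<otimes>\<^bsub>G\<^esub> h) f = \<psi> g (\<psi> h f)" if "g \<in> carrier G" "h \<in> carrier G" "f \<in> C" for g h f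
      using that C_inv[of "inv\<^bsub>G\<^esub> h" f]
      by (auto simp: \<psi>_def inv_mult_group A.composition_rule \<phi>_in intro!: restrict_ext)
  qed (auto simp: \<psi>_def is_group)
  moreover have "continuous_map (prod_topology T ?X) ?X (\<lambda>(g, f). \<psi> g f)"
  proof -
    have "continuous_map (prod_topology T ?X) ?P (\<lambda>(g, f). \<lambda>i\<in>I. f (\<phi> (inv\<^bsub>G\<^esub> g) i))"
      unfolding continuous_map_componentwise
    proof (intro conjI ballI)
      fix i assume i: "i \<in> I"
      let ?h = "\<lambda>(g, f). f (\<phi> (inv\<^bsub>G\<^esub> g) i)"
      have "continuous_map (prod_topology T ?X) K ?h"
        unfolding continuous_map_def
      proof (intro conjI allI impI)
        show "?h \<in> topspace (prod_topology T ?X) \<rightarrow> topspace K"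
          using C_sub \<phi>_in i by (auto simp: topspace_eq topX)
        fix U assume U: "openin K U"
        have "{p \<in> topspace (prod_topology T ?X). ?h p \<in> U} =
            (\<Union>j\<in>I. {g \<in> carrier G. \<phi> g j = i} \<times> {f \<in> topspace ?X. f j \<in> U})"
        proof -
          have "\<phi> (inv\<^bsub>G\<^esub> g) i = j \<longleftrightarrow> \<phi> g j = i" if "g \<in> carrier G" "j \<in> I" for g j
            using that i A.orbit_sym_aux[of g j i] A.orbit_sym_aux[of "inv\<^bsub>G\<^esub> g" i j] by auto
          then have "(\<exists>j\<in>I. \<phi> g j = i \<and> f j \<in> U) \<longleftrightarrow> f (\<phi> (inv\<^bsub>G\<^esub> g) i) \<in> U"
            if "g \<in> carrier G" for g and f :: "'i \<Rightarrow> 'k"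
            using that \<phi>_in[of "inv\<^bsub>G\<^esub> g" i] i by (metis inv_closed)
          then show ?thesis unfolding topTX topX by auto
        qed
        moreover have "openin ?X {f \<in> topspace ?X. f j \<in> U}" if "j \<in> I" for j
        proof -
          have "continuous_map ?X K (\<lambda>f. f j)"
            by (intro continuous_map_from_subtopology continuous_map_product_projection that)
          then show ?thesis using U by (rule openin_continuous_map_preimage)
        qed
        ultimately show "openin (prod_topology T ?X) {p \<in> topspace (prod_topology T ?X). ?h p \<in> U}"
          using op i by (simp only:) (intro openin_Union ballI; auto simp: openin_prod_Times_iff)
      qed
      then show "continuous_map (prod_topology T ?X) K
          (\<lambda>p. (case p of (g, f) \<Rightarrow> \<lambda>i\<in>I. f (\<phi> (inv\<^bsub>G\<^esub> g) i)) i)"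
        using i by (simp add: case_prod_unfold)
    qed auto
    then have "continuous_map (prod_topology T ?X) ?X (\<lambda>(g, f). \<lambda>i\<in>I. f (\<phi> (inv\<^bsub>G\<^esub> g) i))"
      by (rule continuous_map_into_subtopology)
         (unfold topTX, use C_inv in auto)
    then show ?thesis by (rule continuous_map_eq) (unfold topTX, auto simp: \<psi>_def)
  qed
  ultimately have "continuous_action G T ?X \<psi>"
    by (simp only: continuous_action_def topX)
  moreover have "compact_space ?X"
    using K C(1) by (intro compact_space_subtopology closedin_compact_space)
      (auto simp: compact_space_product_topology)
  moreover have "Hausdorff_space ?X"
    using K by (intro Hausdorff_space_subtopology) (simp add: Hausdorff_space_product_topology)
  ultimately obtain f where f: "f \<in> C" "\<And>g. g \<in> carrier G \<Longrightarrow> \<psi> g f = f"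
    using extremely_amenable_fixed_point[OF ea, of ?X \<psi>] C(2) unfolding topX by blast
  have "f (\<phi> g i) = f i" if "g \<in> carrier G" "i \<in> I" for g i
  proof -
    have "\<psi> (inv\<^bsub>G\<^esub> g) f i = f (\<phi> g i)" using that f(1) by (simp add: \<psi>_def)
    then show ?thesis using that f(2)[of "inv\<^bsub>G\<^esub> g"] by simp
  qed
  then show ?thesis using f(1) by blast
qed

lemma continuous_pair_action:
  assumes "topological_group G T" and act: "continuous_action G T (discrete_topology M) \<phi>"
  shows "continuous_action G T (discrete_topology (M \<times> M)) (pair_action M \<phi>)"
proof -
  interpret topological_group G T by fact
  interpret A: group_action G M \<phi> using act by (simp add: continuous_action_def)
  have \<phi>_in: "\<phi> g x \<in> M" if "g \<in> carrier G" "x \<in> M" for g x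
    using that A.element_image by blast
  have \<phi>_one: "\<phi> \<one>\<^bsub>G\<^esub> x = x" if "x \<in> M" for x
    using that A.id_eq_one by (metis restrict_apply')
  have "group_action G (M \<times> M) (pair_action M \<phi>)"
    by (rule group_actionI)
       (auto simp: pair_action_def \<phi>_in \<phi>_one A.composition_rule is_group)
  moreover have "openin T {g \<in> carrier G. pair_action M \<phi> g p = q}"
    if "p \<in> M \<times> M" "q \<in> M \<times> M" for p q
  proof -
    have "{g \<in> carrier G. pair_action M \<phi> g p = q} =
        {g \<in> carrier G. \<phi> g (fst p) = fst q} \<inter> {g \<in> carrier G. \<phi> g (snd p) = snd q}"
      using that by (auto simp: pair_action_def)
    then show ?thesis
      using act that by (auto simp: continuous_action_discrete_iff[OF topspace_eq])
  qed
  ultimately show ?thesis by (simp add: continuous_action_discrete_iff[OF topspace_eq])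
qed

lemma continuous_action_subgroup:
  assumes "topological_group G T" and act: "continuous_action G T (discrete_topology I) \<phi>"
    and H: "subgroup H G"
  shows "continuous_action (G\<lparr>carrier := H\<rparr>) (subtopology T H) (discrete_topology I) \<phi>"
proof -
  interpret topological_group G T by fact
  have "H \<subseteq> carrier G" using H by (rule subgroup.subset)
  then have top: "topspace (subtopology T H) = carrier (G\<lparr>carrier := H\<rparr>)"
    by (auto simp: topspace_eq)
  have "group_action (G\<lparr>carrier := H\<rparr>) I \<phi>"
    using act H by (simp add: continuous_action_def group_action.induced_action)
  moreover have "openin (subtopology T H) {g \<in> H. \<phi> g x = y}" if "x \<in> I" "y \<in> I" for x y
  proof -
    have "{g \<in> H. \<phi> g x = y} = H \<inter> {g \<in> carrier G. \<phi> g x = y}"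
      using \<open>H \<subseteq> carrier G\<close> by auto
    then show ?thesis
      using act that by (simp add: continuous_action_discrete_iff[OF topspace_eq]
          openin_subtopology_Int2)
  qed
  ultimately show ?thesis by (simp add: continuous_action_discrete_iff[OF top])
qed


section \<open>An invariant orientation\<close>

lemma orients_pullback:
  assumes u: "graph_automorphism M R u" and f: "orients k R M f"
  shows "orients k R M (\<lambda>(x, y). f (u x, u y))"
proof -
  have u_in: "u x \<in> M" if "x \<in> M" for x
    using u that by (auto simp: graph_automorphism_def bij_betw_def)
  have inj: "inj_on u {y \<in> M. f (u x, u y)}" for x
    using u by (auto simp: graph_automorphism_def bij_betw_def inj_on_def)
  have sub: "u ` {y \<in> M. f (u x, u y)} \<subseteq> {y \<in> M. f (u x, y)}" for x using u_in by auto
  have "finite {y \<in> M. f (u x, u y)} \<and> card {y \<in> M. f (u x, u y)} \<le> k" if "x \<in> M" for x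
  proof -
    have "finite {y \<in> M. f (u x, y)}" "card {y \<in> M. f (u x, y)} \<le> k"
      using f u_in[OF that] by (auto simp: orients_def)
    then show ?thesis
      using inj_on_finite[OF inj sub] card_inj_on_le[OF inj sub] by (meson le_trans)
  qed
  moreover have "f (u x, u y) \<or> f (u y, u x)" if "x \<in> M" "y \<in> M" "{x, y} \<in> R" for x y
    using that u f u_in by (auto simp: orients_def graph_automorphism_def)
  ultimately show ?thesis by (simp add: orients_def)
qed

lemma invariant_orientation:
  assumes graph: "simple_graph M R" "k_sparse k M R"
    and act: "continuous_action G T (discrete_topology M) \<phi>"
    and aut: "\<And>g. g \<in> carrier G \<Longrightarrow> graph_automorphism M R (\<phi> g)"
    and ea: "extremely_amenable G T"
  shows "\<exists>f. orients k R M f \<and>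
           (\<forall>g\<in>carrier G. \<forall>x\<in>M. \<forall>y\<in>M. f (\<phi> g x, \<phi> g y) = f (x, y))"
proof -
  have G: "topological_group G T" using ea by (simp add: extremely_amenable_def)
  have "\<exists>f \<in> orientations k M R. \<forall>g\<in>carrier G. \<forall>p\<in>M \<times> M. f (pair_action M \<phi> g p) = f p"
  proof (rule extremely_amenable_invariant_function[OF ea continuous_pair_action[OF G act],
        where K = "discrete_topology UNIV"])
    fix g f assume g: "g \<in> carrier G" and f: "f \<in> orientations k M R"
    have "orients k R M (\<lambda>(x, y). f (\<phi> g x, \<phi> g y))"
      using f by (intro orients_pullback[OF aut[OF g]]) (simp add: orientations_def)
    then have "orients k R M (\<lambda>p\<in>M \<times> M. f (pair_action M \<phi> g p))"
      by (subst orients_cong[where h = "\<lambda>(x, y). f (\<phi> g x, \<phi> g y)"])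
         (auto simp: pair_action_def)
    then show "(\<lambda>p\<in>M \<times> M. f (pair_action M \<phi> g p)) \<in> orientations k M R"
      by (simp add: orientations_def)
  qed (simp_all add: closedin_orientations orientations_nonempty[OF graph]
      compact_space_discrete_topology)
  then obtain f where f: "f \<in> orientations k M R"
      "\<And>g p. g \<in> carrier G \<Longrightarrow> p \<in> M \<times> M \<Longrightarrow> f (pair_action M \<phi> g p) = f p"
    by blast
  have "f (\<phi> g x, \<phi> g y) = f (x, y)" if "g \<in> carrier G" "x \<in> M" "y \<in> M" for g x y
    using f(2)[of g "(x, y)"] that by (simp add: pair_action_def)
  then show ?thesis using f(1) by (auto simp: orientations_def)
qed


section \<open>Descendants in an invariant orientation\<close>

lemma relpow_out_bounded:
  fixes D :: "'v rel"
  assumes D: "\<And>x. finite (D `` {x}) \<and> card (D `` {x}) \<le> k"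
  shows "finite ((D ^^ n) `` {x}) \<and> card ((D ^^ n) `` {x}) \<le> k ^ n"
proof (induction n)
  case 0
  then show ?case by simp
next
  case (Suc n)
  have eq: "(D ^^ Suc n) `` {x} = (\<Union>y \<in> (D ^^ n) `` {x}. D `` {y})" by auto
  have "card (\<Union>y \<in> (D ^^ n) `` {x}. D `` {y}) \<le> (\<Sum>y \<in> (D ^^ n) `` {x}. card (D `` {y}))"
    using Suc.IH by (intro card_UN_le) simp
  also have "\<dots> \<le> card ((D ^^ n) `` {x}) * k"
    using D by (intro sum_bounded_above[THEN order_trans]) auto
  also have "\<dots> \<le> k ^ n * k" using Suc.IH by (intro mult_right_mono) auto
  finally have "card ((D ^^ Suc n) `` {x}) \<le> k ^ Suc n" by (simp only: eq power_Suc mult.commute)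
  moreover have "finite ((D ^^ Suc n) `` {x})" using Suc.IH D by (simp only: eq) blast
  ultimately show ?case by blast
qed

text \<open>An invariant set is determined by the set of orbits that it contains.\<close>
lemma finite_invariant_sets:
  assumes "group_action G E \<psi>" and fin: "finite (orbits G E \<psi>)"
  shows "finite {S. S \<subseteq> E \<and> (\<forall>g\<in>carrier G. \<psi> g ` S \<subseteq> S)}"
proof (rule finite_subset)
  interpret group_action G E \<psi> by fact
  show "finite (Union ` Pow (orbits G E \<psi>))" using fin by simp
  show "{S. S \<subseteq> E \<and> (\<forall>g\<in>carrier G. \<psi> g ` S \<subseteq> S)} \<subseteq> Union ` Pow (orbits G E \<psi>)"
  proof
    fix S assume S: "S \<in> {S. S \<subseteq> E \<and> (\<forall>g\<in>carrier G. \<psi> g ` S \<subseteq> S)}"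
    then have "S = \<Union> (orbit G \<psi> ` S)"
      using orbit_refl by (fastforce simp: orbit_def)
    moreover have "orbit G \<psi> ` S \<in> Pow (orbits G E \<psi>)" using S by (auto simp: orbits_def)
    ultimately show "S \<in> Union ` Pow (orbits G E \<psi>)" by (rule image_eqI)
  qed
qed

text \<open>
  If there are only finitely many different powers, \<open>D\<^sup>+\<close> is a union of finitely many of them,
  and their out-degree bounds add up.
\<close>
lemma trancl_out_bounded:
  fixes D :: "'v rel"
  assumes D: "\<And>x. finite (D `` {x}) \<and> card (D `` {x}) \<le> k"
    and fin: "finite (range (\<lambda>n. D ^^ Suc n))"
  shows "\<exists>K. \<forall>x. finite (D\<^sup>+ `` {x}) \<and> card (D\<^sup>+ `` {x}) \<le> K"
proof -
  obtain N where N: "finite N" "range (\<lambda>n. D ^^ Suc n) = (\<lambda>n. D ^^ Suc n) ` N"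
    using finite_subset_image[OF fin, of "\<lambda>n. D ^^ Suc n" UNIV] by auto
  have "p \<in> D\<^sup>+ \<longleftrightarrow> (\<exists>n. p \<in> D ^^ Suc n)" for p
    by (metis trancl_power gr0_conv_Suc zero_less_Suc)
  then have "D\<^sup>+ = \<Union> (range (\<lambda>n. D ^^ Suc n))" by blast
  then have eq: "D\<^sup>+ `` {x} = (\<Union>n\<in>N. (D ^^ Suc n) `` {x})" for x
    unfolding N(2) by (auto simp del: relpow.simps)
  have "finite (D\<^sup>+ `` {x}) \<and> card (D\<^sup>+ `` {x}) \<le> (\<Sum>n\<in>N. k ^ Suc n)" for x
  proof
    show "finite (D\<^sup>+ `` {x})"
      unfolding eq using N(1) relpow_out_bounded[OF D] by blast
    have "card (D\<^sup>+ `` {x}) \<le> (\<Sum>n\<in>N. card ((D ^^ Suc n) `` {x}))"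
      unfolding eq using N(1) by (rule card_UN_le)
    also have "\<dots> \<le> (\<Sum>n\<in>N. k ^ Suc n)"
      using relpow_out_bounded[OF D] by (intro sum_mono) blast
    finally show "card (D\<^sup>+ `` {x}) \<le> (\<Sum>n\<in>N. k ^ Suc n)" .
  qed
  then show ?thesis by blast
qed

text \<open>
  Walk backwards along \<open>D\<close>, each time to an in-neighbour that has not been visited yet. The
  clause \<open>b \<notin> A\<close> makes the count go up by one in each step.
\<close>
lemma many_descendants:
  assumes "M \<noteq> {}" and inf: "\<And>b. b \<in> M \<Longrightarrow> infinite {a \<in> M. (a, b) \<in> D}"
  shows "\<exists>b\<in>M. \<exists>A. finite A \<and> card A = n \<and> b \<notin> A \<and> A \<subseteq> D\<^sup>+ `` {b}"
proof (induction n)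
  case 0
  then show ?case using \<open>M \<noteq> {}\<close> by fastforce
next
  case (Suc n)
  then obtain b A where b: "b \<in> M" "finite A" "card A = n" "b \<notin> A" "A \<subseteq> D\<^sup>+ `` {b}"
    by blast
  then have "infinite ({a \<in> M. (a, b) \<in> D} - insert b A)" using inf by simp
  then have "{a \<in> M. (a, b) \<in> D} - insert b A \<noteq> {}" by (rule infinite_imp_nonempty)
  then obtain a where a: "a \<in> M" "(a, b) \<in> D" "a \<notin> insert b A" by blast
  have "insert b A \<subseteq> D\<^sup>+ `` {a}" using a b by (auto intro: trancl_into_trancl2)
  then show ?case using a b by (intro bexI[of _ a] exI[of _ "insert b A"]) auto
qed

lemma relpow_pair_invariant:
  assumes inv: "\<And>x y. (x, y) \<in> D \<Longrightarrow> (u x, u y) \<in> D" and xy: "(x, y) \<in> D ^^ n"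
  shows "(u x, u y) \<in> D ^^ n"
  using xy
proof (induction n arbitrary: y)
  case (Suc n)
  then show ?case using inv by (auto intro: relcompI)
qed simp

theorem theorem3p7:
  fixes k :: nat
    and M :: "'v set" and R :: "'v set set"
    and G :: "('g, 'r) monoid_scheme" and T :: "'g topology"
    and \<phi> :: "'g \<Rightarrow> 'v \<Rightarrow> 'v" and H :: "'g set"
  assumes "simple_graph M R" and "M \<noteq> {}"
    and "k_sparse k M R"
    and "\<And>x. x \<in> M \<Longrightarrow> infinite (neighbours R x)"
    and "topological_group G T"
    and "acts_by_automorphisms G T M R \<phi>"
    and "subgroup H G"
    and "extremely_amenable (G\<lparr>carrier := H\<rparr>) (subtopology T H)"
  shows "infinite (orbits (G\<lparr>carrier := H\<rparr>) (M \<times> M) (pair_action M \<phi>))"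
proof
  let ?H = "G\<lparr>carrier := H\<rparr>"
  assume fin: "finite (orbits ?H (M \<times> M) (pair_action M \<phi>))"
  have H: "topological_group ?H (subtopology T H)"
    using assms(8) by (simp add: extremely_amenable_def)
  have act: "continuous_action ?H (subtopology T H) (discrete_topology M) \<phi>"
    using assms(5,6,7) by (intro continuous_action_subgroup) (auto simp: acts_by_automorphisms_def)
  have aut: "graph_automorphism M R (\<phi> g)" if "g \<in> carrier ?H" for g
    using that assms(6) subgroup.subset[OF assms(7)] by (auto simp: acts_by_automorphisms_def)
  have \<phi>_in: "\<phi> g x \<in> M" if "g \<in> carrier ?H" "x \<in> M" for g x
    using aut[OF that(1)] that(2) by (auto simp: graph_automorphism_def bij_betw_def)
  obtain f where f: "orients k R M f"
    and f_inv: "\<And>g x y. g \<in> carrier ?H \<Longrightarrow> x \<in> M \<Longrightarrow> y \<in> M \<Longrightarrow> f (\<phi> g x, \<phi> g y) = f (x, y)"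
    using invariant_orientation[OF assms(1,3) act aut assms(8)] by blast
  (* Outside M \<times> M the values of f are arbitrary, hence the restriction. *)
  define D where "D = {p \<in> M \<times> M. f p}"
  have D_out: "finite (D `` {x}) \<and> card (D `` {x}) \<le> k" for x
  proof (cases "x \<in> M")
    case True
    then have "D `` {x} = {y \<in> M. f (x, y)}" by (auto simp: D_def)
    then show ?thesis using f True by (simp add: orients_def)
  next
    case False
    then have "D `` {x} = {}" by (auto simp: D_def)
    then show ?thesis by simp
  qed
  have D_in: "infinite {a \<in> M. (a, b) \<in> D}" if b: "b \<in> M" for b
  proof
    assume "finite {a \<in> M. (a, b) \<in> D}"
    moreover have "neighbours R b \<subseteq> {a \<in> M. (a, b) \<in> D} \<union> D `` {b}"
    proof
      fix a assume "a \<in> neighbours R b"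
      then have ab: "{b, a} \<in> R" by (simp add: neighbours_def)
      then have "a \<in> M" using simple_graph.edges[OF assms(1)] by blast
      then show "a \<in> {a \<in> M. (a, b) \<in> D} \<union> D `` {b}"
        using f b ab by (auto simp: D_def orients_def)
    qed
    ultimately show False
      using assms(4)[OF b] D_out[of b] finite_subset finite_Un by metis
  qed
  have "D ^^ Suc n \<in> {S. S \<subseteq> M \<times> M \<and> (\<forall>g\<in>carrier ?H. pair_action M \<phi> g ` S \<subseteq> S)}" for n
  proof -
    have "D\<^sup>+ \<subseteq> M \<times> M" by (rule trancl_subset_Sigma) (auto simp: D_def)
    moreover have "D ^^ Suc n \<subseteq> D\<^sup>+" using trancl_power by blast
    ultimately have sub: "D ^^ Suc n \<subseteq> M \<times> M" by (rule order_trans[rotated])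
    have "(\<phi> g x, \<phi> g y) \<in> D ^^ Suc n" if "g \<in> carrier ?H" "(x, y) \<in> D ^^ Suc n" for g x y
    proof (rule relpow_pair_invariant[OF _ that(2)])
      show "(\<phi> g x, \<phi> g y) \<in> D" if "(x, y) \<in> D" for x y
        using that f_inv \<phi>_in \<open>g \<in> carrier ?H\<close> by (simp add: D_def)
    qed
    then show ?thesis using sub by (auto simp: pair_action_def simp del: relpow.simps)
  qed
  moreover have "group_action ?H (M \<times> M) (pair_action M \<phi>)"
    using continuous_pair_action[OF H act] by (simp add: continuous_action_def)
  ultimately have "finite (range (\<lambda>n. D ^^ Suc n))"
    using finite_invariant_sets[OF _ fin] by (meson finite_subset image_subsetI)
  from trancl_out_bounded[OF D_out this]
  obtain K where K: "\<And>x. finite (D\<^sup>+ `` {x})" "\<And>x. card (D\<^sup>+ `` {x}) \<le> K" by blast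
  obtain b A where "card A = Suc K" "A \<subseteq> D\<^sup>+ `` {b}"
    using many_descendants[OF assms(2) D_in] by blast
  then show False using card_mono[OF K(1)] K(2) by (metis Suc_n_not_le_n le_trans)
qed

end
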